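(* Let $\mathcal{R}(x)=-2\psi(x)-2\gamma$ for $x>0$. For $x\in(0,1)$, $$\mathcal{R}(x)=\frac{2}{x}+2\sum_{n=1}^{\infty}(-1)^n\zeta(n+1)x^n.$$ Moreover, for every integer $n\ge 1$, the function $$x\mapsto\frac{(-1)^{n-1}}{x^{n+1}}\left[\mathcal{R}(x)-\frac{2}{x}-2\sum_{k=1}^{n}(-1)^k\zeta(k+1)x^k\right]$$ is completely monotonic on $(0,\infty)$.
   Context: $\psi(x)=\frac{d}{dx}\ln\Gamma(x)$ is the psi (digamma) function, $\gamma=-\psi(1)$ is the Euler constant, and $\zeta(s)=\sum_{n=1}^\infty n^{-s}$ is the Riemann zeta function. A function $f$ is completely monotonic on an interval $I$ if it has derivatives of all orders on $I$ and $(-1)^m f^{(m)}(x)\ge 0$ for all $x\in I$ and all integers $m\ge 0$. *)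

theory Defs
  imports "HOL-Analysis.Analysis"
begin

text \<open>
  The series defining \<^term>\<open>zeta s\<close> converges for \<open>s > 1\<close>; it is not meant to be used elsewhere.
\<close>

definition zeta :: "real \<Rightarrow> real" where
  "zeta s = (\<Sum>n. 1 / real (Suc n) powr s)"

text \<open>
  The function \<open>D m\<close> is the \<open>m\<close>-th derivative of \<open>f\<close> on \<open>I\<close>, one-sided at endpoints that
  belong to \<open>I\<close>. On a nondegenerate interval the values of all \<open>D m\<close> on \<open>I\<close> are uniquely
  determined by \<open>f\<close>, so the existential quantifier says that all the derivatives exist.
\<close>

definition completely_monotonic_on :: "real set \<Rightarrow> (real \<Rightarrow> real) \<Rightarrow> bool" where
  "completely_monotonic_on I f \<longleftrightarrow>
     (\<exists>D. (\<forall>x\<in>I. D 0 x = f x) \<and>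
          (\<forall>m. \<forall>x\<in>I. (D m has_real_derivative D (Suc m) x) (at x within I)) \<and>
          (\<forall>m. \<forall>x\<in>I. (-1) ^ m * D m x \<ge> 0))"

text \<open>
  The library defines \<^const>\<open>Digamma\<close> by a series; on the positive reals it is the derivative of
  \<^term>\<open>ln_Gamma :: real \<Rightarrow> real\<close> (\<open>has_field_derivative_ln_Gamma_real\<close>). Likewise
  \<^const>\<open>euler_mascheroni\<close> equals \<open>- Digamma 1\<close> (\<open>Digamma_1\<close>).
\<close>

definition ramanujan_R :: "real \<Rightarrow> real" where
  "ramanujan_R x = - 2 * Digamma x - 2 * euler_mascheroni"

end

theory Submission
  imports Defs
begin

text \<open>
  Expanding each term of \<open>\<psi>(x + 1) + \<gamma> = (\<Sum>k\<ge>1. 1/k - 1/(k + x))\<close> as a finite geometric sum in \<open>x/k\<close>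
  and summing over \<open>k\<close>, one sees that the remainder after the \<open>n\<close>-th zeta coefficient is
  \<open>2 (-x)^(n+1) (\<Sum>k\<ge>1. 1 / (k^(n+1) (k + x)))\<close>. For \<open>0 < x < 1\<close> it tends to \<open>0\<close>, and the series
  occurring in it is a sum of completely monotonic functions that can be differentiated termwise.
\<close>

text \<open>The second exponent closes the family under differentiation: \<open>m = 1\<close> is the
  remainder series, larger \<open>m\<close> occur in its derivatives, and \<open>m = 0\<close> gives
  back the zeta coefficients.\<close>

definition shifted_zeta :: "nat \<Rightarrow> nat \<Rightarrow> real \<Rightarrow> real" where
  "shifted_zeta p m x = (\<Sum>k. 1 / (real (Suc k) ^ p * (real (Suc k) + x) ^ m))"

lemma shifted_zeta_0_right: "shifted_zeta p 0 x = zeta (real p)"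
  unfolding shifted_zeta_def zeta_def by (simp add: powr_realpow)

text \<open>The majorant does not depend on \<open>p\<close>, \<open>m\<close> or \<open>x\<close>,
  so it serves for summability, for uniform convergence of the differentiated series and for the
  limit of the remainders.\<close>

lemma shifted_zeta_term_le:
  assumes "p \<ge> 2" "x \<ge> 0"
  shows "norm (1 / (real (Suc k) ^ p * (real (Suc k) + x) ^ m)) \<le> inverse (real (Suc k) ^ 2)"
proof -
  have "real (Suc k) ^ 2 * 1 \<le> real (Suc k) ^ p * (real (Suc k) + x) ^ m"
    using assms by (intro mult_mono power_increasing one_le_power) auto
  thus ?thesis
    using assms by (simp add: field_simps)
qed

lemma summable_inverse_Suc_squares: "summable (\<lambda>k. inverse (real (Suc k) ^ 2))"
  by (subst summable_Suc_iff) (rule inverse_power_summable, simp)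

lemma summable_shifted_zeta:
  assumes "p \<ge> 2" "x \<ge> 0"
  shows "summable (\<lambda>k. 1 / (real (Suc k) ^ p * (real (Suc k) + x) ^ m))"
  by (rule summable_comparison_test'[OF summable_inverse_Suc_squares, of 0])
     (rule shifted_zeta_term_le[OF assms])

lemma shifted_zeta_nonneg: "p \<ge> 2 \<Longrightarrow> x \<ge> 0 \<Longrightarrow> shifted_zeta p m x \<ge> 0"
  unfolding shifted_zeta_def by (intro suminf_nonneg summable_shifted_zeta) auto

lemma shifted_zeta_le:
  assumes "p \<ge> 2" "x \<ge> 0"
  shows "shifted_zeta p m x \<le> (\<Sum>k. inverse (real (Suc k) ^ 2))"
  unfolding shifted_zeta_def
  by (intro suminf_le summable_shifted_zeta assms summable_inverse_Suc_squares)
     (rule order_trans[OF abs_ge_self shifted_zeta_term_le[OF assms, unfolded real_norm_def]])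

lemma has_real_derivative_inverse_power:
  fixes c t :: real
  assumes "c \<noteq> 0" "t \<noteq> 0"
  shows "((\<lambda>t. 1 / (c * t ^ m)) has_real_derivative - real m * (1 / (c * t ^ Suc m))) (at t)"
proof (cases m)
  case (Suc l)
  \<comment> \<open>Differentiating \<open>t ^ l\<close> yields the truncated exponent
    \<open>l - Suc 0\<close>; at \<open>l = 0\<close> the factor \<open>real l\<close> makes both
    sides vanish.\<close>
  have "real l * t ^ (l - Suc 0) * t = real l * t ^ l"
    by (cases l) auto
  thus ?thesis
    using assms by (auto intro!: derivative_eq_intros simp: divide_simps left_diff_distrib Suc)
qed auto

lemma has_real_derivative_shifted_zeta:
  assumes "p \<ge> 2" "x > 0"
  shows "(shifted_zeta p m has_real_derivative - real m * shifted_zeta p (Suc m) x) (at x)"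
proof -
  let ?f = "\<lambda>m k x. 1 / (real (Suc k) ^ p * (real (Suc k) + x) ^ m)"
  have "((\<lambda>x. \<Sum>k. ?f m k x) has_real_derivative (\<Sum>k. - real m * ?f (Suc m) k x)) (at x)"
  \<comment> \<open>The \<open>1\<close> is the base point in \<open>{0<..}\<close> at which the
    undifferentiated series has to converge.\<close>
  proof (rule has_field_derivative_series'(2)[of "{0<..}" _ _ 1])
    fix k and y :: real
    assume "y \<in> {0<..}"
    hence "(?f m k has_real_derivative - real m * ?f (Suc m) k y) (at y)"
      using has_real_derivative_inverse_power[of "real (Suc k) ^ p" "y + real (Suc k)" m]
      by (auto simp: DERIV_shift add.commute simp del: of_nat_Suc)
    thus "(?f m k has_real_derivative - real m * ?f (Suc m) k y) (at y within {0<..})"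
      by (rule has_field_derivative_at_within)
  next
    show "uniformly_convergent_on {0<..} (\<lambda>n y. \<Sum>k<n. - real m * ?f (Suc m) k y)"
    proof (rule Weierstrass_m_test')
      fix k and y :: real
      assume "y \<in> {0<..}"
      hence "real m * norm (?f (Suc m) k y) \<le> real m * inverse (real (Suc k) ^ 2)"
        by (intro mult_left_mono shifted_zeta_term_le assms) auto
      thus "norm (- real m * ?f (Suc m) k y) \<le> real m * inverse (real (Suc k) ^ 2)"
        by (simp add: abs_mult)
    next
      show "summable (\<lambda>k. real m * inverse (real (Suc k) ^ 2))"
        by (intro summable_mult summable_inverse_Suc_squares)
    qed
  qed (use assms in \<open>auto intro!: summable_shifted_zeta simp del: of_nat_Suc simp: interior_open\<close>)
  also have "(\<Sum>k. - real m * ?f (Suc m) k x) = - real m * shifted_zeta p (Suc m) x"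
    unfolding shifted_zeta_def using assms by (intro suminf_mult summable_shifted_zeta) auto
  finally show ?thesis
    unfolding shifted_zeta_def [abs_def] .
qed

lemma completely_monotonic_shifted_zeta:
  assumes "p \<ge> 2"
  shows "completely_monotonic_on {0<..} (\<lambda>x. 2 * shifted_zeta p 1 x)"
  unfolding completely_monotonic_on_def
\<comment> \<open>Starting from exponent 1, the derivative rule contributes the factors -1, -2, ...,
  -m, whose product is \<open>(-1) ^ m * fact m\<close>.\<close>
proof (intro exI[of _ "\<lambda>m x. 2 * (-1) ^ m * fact m * shifted_zeta p (Suc m) x"] conjI allI ballI)
  fix m and x :: real
  assume x: "x \<in> {0<..}"
  show "((\<lambda>x. 2 * (-1) ^ m * fact m * shifted_zeta p (Suc m) x) has_real_derivative
          2 * (-1) ^ Suc m * fact (Suc m) * shifted_zeta p (Suc (Suc m)) x) (at x within {0<..})"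
    using assms x
    by (auto intro!: derivative_eq_intros has_field_derivative_at_within
          [OF has_real_derivative_shifted_zeta] simp: algebra_simps)
  show "(-1) ^ m * (2 * (-1) ^ m * fact m * shifted_zeta p (Suc m) x) \<ge> 0"
    using shifted_zeta_nonneg[of p x "Suc m"] assms x
    by (simp add: mult.assoc[symmetric] flip: power_mult_distrib)
qed auto

text \<open>Induction peels one term off the remainder by
  \<open>1 / (a + x) = 1 / a - x / (a * (a + x))\<close>. This is an exact identity, so
  \<open>x\<close> may exceed \<open>a\<close>, as complete monotonicity on the whole half-line
  requires.\<close>

lemma geometric_remainder:
  fixes a x :: real
  assumes "a > 0" "x > 0"
  shows "1 / a - 1 / (x + a) =
    - (\<Sum>j=1..n. (-x) ^ j * (1 / a ^ Suc j)) - (-x) ^ Suc n * (1 / (a ^ Suc n * (a + x)))"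
proof (induction n)
  case 0
  show ?case using assms by (simp add: field_simps)
next
  case (Suc n)
  have "(-x) ^ Suc n * (1 / (a ^ Suc n * (a + x))) =
    (-x) ^ Suc n * (1 / a ^ Suc (Suc n)) + (-x) ^ Suc (Suc n) * (1 / (a ^ Suc (Suc n) * (a + x)))"
    using assms by (simp add: divide_simps) (simp add: algebra_simps)
  with Suc show ?case by simp
qed

lemma ramanujan_R_remainder:
  assumes "x > 0" "n \<ge> 1"
  shows "ramanujan_R x - 2 / x - 2 * (\<Sum>k=1..n. (-1) ^ k * zeta (real (k + 1)) * x ^ k) =
    2 * (-x) ^ Suc n * shifted_zeta (Suc n) 1 x"
proof -
  let ?c = "\<lambda>j k. 1 / real (Suc k) ^ Suc j"
  let ?r = "\<lambda>k. 1 / (real (Suc k) ^ Suc n * (real (Suc k) + x) ^ 1)"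
  have c: "?c j sums zeta (real (j + 1))" if "j \<in> {1..n}" for j
    using summable_sums[OF summable_shifted_zeta[of "Suc j" 0 0]] that
      shifted_zeta_0_right[of "Suc j" 0]
    by (simp add: shifted_zeta_def)
  have r: "?r sums shifted_zeta (Suc n) 1 x"
    unfolding shifted_zeta_def using assms
    by (intro summable_sums summable_shifted_zeta) auto
  have "(\<lambda>k. - (\<Sum>j=1..n. (-x) ^ j * ?c j k) - (-x) ^ Suc n * ?r k) sums
      (- (\<Sum>j=1..n. (-x) ^ j * zeta (real (j + 1))) - (-x) ^ Suc n * shifted_zeta (Suc n) 1 x)"
    by (intro sums_diff sums_minus sums_sum sums_mult c r)
  \<comment> \<open>With \<open>a = Suc k\<close> the geometric identity produces the summand of the
    series defining \<open>Digamma\<close> at \<open>x + 1\<close>; the recurrence back to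
    \<open>x\<close> later supplies the term \<open>2 / x\<close>.\<close>
  also have "(\<lambda>k. - (\<Sum>j=1..n. (-x) ^ j * ?c j k) - (-x) ^ Suc n * ?r k) =
      (\<lambda>k. inverse (of_nat (Suc k)) - inverse (x + 1 + of_nat k))"
    using geometric_remainder[of "real (Suc _)" x n] assms
    by (simp add: fun_eq_iff inverse_eq_divide add_ac)
  finally have "Digamma (x + 1) + euler_mascheroni =
      - (\<Sum>j=1..n. (-x) ^ j * zeta (real (j + 1))) - (-x) ^ Suc n * shifted_zeta (Suc n) 1 x"
    by (simp add: Digamma_def sums_iff)
  moreover have "ramanujan_R x = 2 / x - 2 * (Digamma (x + 1) + euler_mascheroni)"
    using assms by (simp add: ramanujan_R_def Digamma_plus1)
  moreover have "(\<Sum>j=1..n. (-x) ^ j * zeta (real (j + 1))) =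
      (\<Sum>k=1..n. (-1) ^ k * zeta (real (k + 1)) * x ^ k)"
    by (intro sum.cong refl) (subst power_minus, simp)
  ultimately show ?thesis
    by (simp add: algebra_simps)
qed

lemma ramanujan_R_sums:
  assumes "0 < x" "x < 1"
  shows "(\<lambda>n. (-1) ^ Suc n * zeta (real (Suc n + 1)) * x ^ Suc n) sums (ramanujan_R x / 2 - 1 / x)"
proof -
  let ?S = "\<lambda>n. \<Sum>k=1..n. (-1) ^ k * zeta (real (k + 1)) * x ^ k"
  let ?C = "\<Sum>k. inverse (real (Suc k) ^ 2)"
  have "?S \<longlonglongrightarrow> ramanujan_R x / 2 - 1 / x"
  proof (rule LIM_zero_cancel, rule Lim_null_comparison)
    \<comment> \<open>Since \<open>?C\<close> is independent of \<open>n\<close>, the bound decays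
      geometrically for \<open>x < 1\<close>.\<close>
    show "\<forall>\<^sub>F n in sequentially. norm (?S n - (ramanujan_R x / 2 - 1 / x)) \<le> x ^ Suc n * ?C"
      using eventually_ge_at_top[of 1]
    proof eventually_elim
      case (elim n)
      have "?S n - (ramanujan_R x / 2 - 1 / x) = - ((-x) ^ Suc n * shifted_zeta (Suc n) 1 x)"
        using ramanujan_R_remainder[of x n] assms elim by simp
      also have "norm \<dots> = x ^ Suc n * shifted_zeta (Suc n) 1 x"
        using elim assms shifted_zeta_nonneg[of "Suc n" x 1]
        by (simp add: abs_mult power_abs)
      also have "\<dots> \<le> x ^ Suc n * ?C"
        using elim assms by (intro mult_left_mono shifted_zeta_le) auto
      finally show ?case .
    qed
    show "(\<lambda>n. x ^ Suc n * ?C) \<longlonglongrightarrow> 0"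
      using assms by (intro tendsto_mult_left_zero LIMSEQ_Suc LIMSEQ_power_zero) auto
  qed
  moreover have "?S n = (\<Sum>k<n. (-1) ^ Suc k * zeta (real (Suc k + 1)) * x ^ Suc k)" for n
    using sum.atLeast1_atMost_eq[of "\<lambda>k. (-1) ^ k * zeta (real (k + 1)) * x ^ k" n] by simp
  ultimately show ?thesis
    by (simp add: sums_def)
qed

theorem theorem3:
  shows "(\<forall>x\<in>{0<..<1::real}.
            summable (\<lambda>n. (-1) ^ Suc n * zeta (real (Suc n + 1)) * x ^ Suc n) \<and>
            ramanujan_R x = 2 / x + 2 * (\<Sum>n. (-1) ^ Suc n * zeta (real (Suc n + 1)) * x ^ Suc n))
       \<and> (\<forall>n::nat. n \<ge> 1 \<longrightarrow>
            completely_monotonic_on {0<..}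
              (\<lambda>x. (-1) ^ (n - 1) / x ^ (n + 1) *
                   (ramanujan_R x - 2 / x - 2 * (\<Sum>k=1..n. (-1) ^ k * zeta (real (k + 1)) * x ^ k))))"
proof (intro conjI ballI allI impI)
  fix x :: real
  assume "x \<in> {0<..<1}"
  hence "(\<lambda>n. (-1) ^ Suc n * zeta (real (Suc n + 1)) * x ^ Suc n) sums (ramanujan_R x / 2 - 1 / x)"
    by (intro ramanujan_R_sums) auto
  thus "summable (\<lambda>n. (-1) ^ Suc n * zeta (real (Suc n + 1)) * x ^ Suc n)"
    and "ramanujan_R x = 2 / x + 2 * (\<Sum>n. (-1) ^ Suc n * zeta (real (Suc n + 1)) * x ^ Suc n)"
    unfolding sums_iff by auto
next
  fix n :: nat
  assume n: "n \<ge> 1"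
  have "(-1) ^ (n - 1) / x ^ (n + 1) *
      (ramanujan_R x - 2 / x - 2 * (\<Sum>k=1..n. (-1) ^ k * zeta (real (k + 1)) * x ^ k)) =
      2 * shifted_zeta (Suc n) 1 x" if "x > 0" for x
  proof -
    \<comment> \<open>As \<open>n \<ge> 1\<close>, the exponents add up to the even number
      \<open>2 * n\<close>.\<close>
    have "(-1 :: real) ^ (n - 1) * (-1) ^ Suc n = 1"
      using n by (simp flip: power_add)
    hence "(-1) ^ (n - 1) / x ^ (n + 1) * (2 * (-x) ^ Suc n) = 2"
      using that power_minus[of x "Suc n"] by (simp add: field_simps)
    thus ?thesis
      unfolding ramanujan_R_remainder[OF that n] by (simp only: mult.assoc[symmetric])
  qed
  thus "completely_monotonic_on {0<..}
      (\<lambda>x. (-1) ^ (n - 1) / x ^ (n + 1) *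
        (ramanujan_R x - 2 / x - 2 * (\<Sum>k=1..n. (-1) ^ k * zeta (real (k + 1)) * x ^ k)))"
    \<comment> \<open>Complete monotonicity involves the function only through its values on
      \<open>{0<..}\<close>, so equality there is enough.\<close>
    using completely_monotonic_shifted_zeta[of "Suc n"] n
    by (simp add: completely_monotonic_on_def)
qed

end
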